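(* Let $W(x)\in\mathbb{R}^{p\times p}[x]$ be a monic matrix polynomial of degree $N\ge1$, and let $\{P^{[1]}_k,P^{[2]}_k\}_{k\ge0}$, $\{\hat P^{[1]}_k,\hat P^{[2]}_k\}_{k\ge0}$ be the monic matrix bi-orthogonal polynomials of $d\mu(x)$ and $W(x)d\mu(x)$, with Christoffel--Darboux kernels $K_n$ and $\hat K_n$. Then for every $n\in\{0,1,2,\dots\}$ $$K_n(x,y)+\Big[(\hat P^{[2]}_{n-N+1}(y))^\top,\dots,(\hat P^{[2]}_n(y))^\top\Big](\hat H_{(n,N)})^{-1}\omega_{(n,N)}\begin{bmatrix}P^{[1]}_{n+1}(x)\\ \vdots\\ P^{[1]}_{n+N}(x)\end{bmatrix}=\hat K_n(x,y)W(x),$$ where by convention $\hat P^{[2]}_j=0$ whenever $j<0$.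
   Context: **Bi-orthogonal polynomials.** Let $\mu$ be a $p\times p$ matrix of Borel measures on $\mathbb{R}$ with finite moments $m_n=\int x^n d\mu(x)$, and $M=(m_{i+j})_{i,j\ge0}$. Assume $M=S_1^{-1}HS_2^{-\top}$ and $\hat M:=\left(\int x^{i+j}W(x)d\mu(x)\right)_{i,j\ge0}=\hat S_1^{-1}\hat H\hat S_2^{-\top}$, where $S_i,\hat S_i$ are lower unitriangular block matrices (blocks $p\times p$, diagonal blocks $I_p$) and $H=\mathrm{diag}(H_0,H_1,\dots)$, $\hat H=\mathrm{diag}(\hat H_0,\hat H_1,\dots)$ are block diagonal with nonsingular $p\times p$ blocks. With $\chi(x)=[I_p,I_px,I_px^2,\dots]^\top$ (block column), $P^{[i]}(x)=[P_0^{[i]},P_1^{[i]},\dots]^\top:=S_i\chi(x)$ and $\hat P^{[i]}(x):=\hat S_i\chi(x)$, $i=1,2$. **Kernels.** $K_n(x,y):=\sum_{k=0}^n(P^{[2]}_k(y))^\top H_k^{-1}P^{[1]}_k(x)$ and $\hat K_n(x,y):=\sum_{k=0}^n(\hat P^{[2]}_k(y))^\top\hat H_k^{-1}\hat P^{[1]}_k(x)$. **Connection matrix.** $\Lambda$ is the semi-infinite block shift matrix (identity blocks $I_p$ on the first block superdiagonal, zero elsewhere); for $W(x)=\sum_jA_jx^j$, $W(\Lambda):=\sum_jA_j\Lambda^j$ with $A_j$ acting as $\mathrm{diag}(A_j,A_j,\dots)$. Put $\omega^{[1]}:=\hat S_1W(\Lambda)S_1^{-1}$, with $p\times p$ blocks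 $\omega^{[1]}_{k,l}$ (it satisfies $\omega^{[1]}_{k,l}=0$ for $l<k$ or $l>k+N$, and $\omega^{[1]}_{k,k+N}=I_p$). **Truncations.** $\omega_{(n,N)}\in\mathbb{R}^{Np\times Np}$ is the block matrix with rows indexed by $k=n-N+1,\dots,n$, columns indexed by $l=n+1,\dots,n+N$, and blocks $\omega^{[1]}_{k,l}$ (zero rows when $k<0$). $\hat H_{(n,N)}:=\mathrm{diag}(\hat H_{n-N+1},\dots,\hat H_n)$; blocks with negative index are immaterial (take them to be $I_p$), since they multiply $\hat P^{[2]}_j=0$. *)

theory Defs
  imports
    "HOL-Analysis.Analysis"
    "HOL-Library.Groups_Big_Fun"
    "HOL-Computational_Algebra.Polynomial"
begin

section \<open>Matrices of real Borel measures\<close>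

text \<open>
  The entries of a matrix of measures may be signed. A pair \<open>(\<nu>\<^sub>+, \<nu>\<^sub>-)\<close> of positive Borel measures
  stands for the signed measure \<open>\<nu>\<^sub>+ - \<nu>\<^sub>-\<close>; by the Jordan decomposition every signed Borel measure
  with finite moments arises from a pair as in \<open>finite_moments\<close> below. Positive measures are the
  pairs whose second component is the null measure.
\<close>

type_synonym signed_measure = "real measure \<times> real measure"

definition signed_integral :: "signed_measure \<Rightarrow> (real \<Rightarrow> real) \<Rightarrow> real" where
  "signed_integral \<nu> f = (LINT x|fst \<nu>. f x) - (LINT x|snd \<nu>. f x)"

definition finite_moments :: "signed_measure ^ 'p ^ 'p \<Rightarrow> bool" where
  "finite_moments \<mu> \<longleftrightarrow>
     (\<forall>a b. \<forall>M\<in>{fst (\<mu> $ a $ b), snd (\<mu> $ a $ b)}.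
        sets M = sets borel \<and> (\<forall>n::nat. integrable M (\<lambda>x. x ^ n)))"

text \<open>The matrix integral \<open>\<integral> F(x) d\<mu>(x)\<close> of a matrix-valued function multiplying from the left.\<close>

definition mat_integral ::
    "(real \<Rightarrow> real ^ 'p ^ 'p) \<Rightarrow> signed_measure ^ 'p ^ 'p \<Rightarrow> real ^ 'p ^ 'p" where
  "mat_integral F \<mu> = (\<chi> a b. \<Sum>c\<in>UNIV. signed_integral (\<mu> $ c $ b) (\<lambda>x. F x $ a $ c))"

definition moment :: "signed_measure ^ 'p ^ 'p \<Rightarrow> nat \<Rightarrow> real ^ 'p ^ 'p" where
  "moment \<mu> n = (\<chi> a b. signed_integral (\<mu> $ a $ b) (\<lambda>x. x ^ n))"

section \<open>Matrix polynomials\<close>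

text \<open>
  Multiplication on \<^typ>\<open>real ^ 'p ^ 'p\<close> is componentwise, so \<^typ>\<open>(real ^ 'p ^ 'p) poly\<close> is used only
  for coefficients and degree, never with polynomial multiplication or \<^const>\<open>poly\<close>.
\<close>

definition matpoly_eval :: "(real ^ 'p ^ 'p) poly \<Rightarrow> real \<Rightarrow> real ^ 'p ^ 'p" where
  "matpoly_eval W x = (\<Sum>j\<le>degree W. x ^ j *\<^sub>R coeff W j)"

definition monic_matpoly :: "(real ^ 'p ^ 'p) poly \<Rightarrow> nat \<Rightarrow> bool" where
  "monic_matpoly W N \<longleftrightarrow> degree W = N \<and> coeff W N = mat 1"

section \<open>Semi-infinite block matrices\<close>

type_synonym 'p bmat = "nat \<Rightarrow> nat \<Rightarrow> real ^ 'p ^ 'p"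

text \<open>All products below have finitely many nonzero summands in every entry.\<close>

definition bm_mult :: "'p::finite bmat \<Rightarrow> 'p bmat \<Rightarrow> 'p::finite bmat" (infixl \<open>\<odot>\<close> 70) where
  "A \<odot> B = (\<lambda>i k. Sum_any (\<lambda>j. A i j ** B j k))"

definition bm_diag :: "(nat \<Rightarrow> real ^ 'p ^ 'p) \<Rightarrow> 'p bmat" where
  "bm_diag D = (\<lambda>i j. if i = j then D i else 0)"

definition bm_one :: "'p::finite bmat" where
  "bm_one = bm_diag (\<lambda>_. mat 1)"

definition bm_transpose :: "'p::finite bmat \<Rightarrow> 'p bmat" where
  "bm_transpose A = (\<lambda>i j. transpose (A j i))"

primrec bm_power :: "'p::finite bmat \<Rightarrow> nat \<Rightarrow> 'p::finite bmat" where
  "bm_power A 0 = bm_one"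
| "bm_power A (Suc j) = A \<odot> bm_power A j"

definition lower_unitriangular :: "'p::finite bmat \<Rightarrow> bool" where
  "lower_unitriangular S \<longleftrightarrow> (\<forall>i. S i i = mat 1) \<and> (\<forall>i j. i < j \<longrightarrow> S i j = 0)"

text \<open>The inverse of a lower unitriangular matrix, taken in the group of such matrices.\<close>

definition bm_inv :: "'p::finite bmat \<Rightarrow> 'p::finite bmat" where
  "bm_inv S = (THE T. lower_unitriangular T \<and> S \<odot> T = bm_one \<and> T \<odot> S = bm_one)"

definition shift_matrix :: "'p::finite bmat" where
  "shift_matrix = (\<lambda>i j. if j = Suc i then mat 1 else 0)"

definition matpoly_shift :: "(real ^ 'p ^ 'p) poly \<Rightarrow> 'p::finite bmat" where
  "matpoly_shift W =
     (\<lambda>i k. \<Sum>j\<le>degree W. (bm_diag (\<lambda>_. coeff W j) \<odot> bm_power shift_matrix j) i k)"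

section \<open>Bi-orthogonal polynomials and kernels\<close>

definition moment_matrix :: "signed_measure ^ 'p ^ 'p \<Rightarrow> 'p bmat" where
  "moment_matrix \<mu> = (\<lambda>i j. moment \<mu> (i + j))"

definition perturbed_moment_matrix ::
    "(real ^ 'p ^ 'p) poly \<Rightarrow> signed_measure ^ 'p ^ 'p \<Rightarrow> 'p bmat" where
  "perturbed_moment_matrix W \<mu> =
     (\<lambda>i j. mat_integral (\<lambda>x. x ^ (i + j) *\<^sub>R matpoly_eval W x) \<mu>)"

definition gauss_borel ::
    "'p::finite bmat \<Rightarrow> 'p bmat \<Rightarrow> (nat \<Rightarrow> real ^ 'p ^ 'p) \<Rightarrow> 'p::finite bmat \<Rightarrow> bool" where
  "gauss_borel M S1 H S2 \<longleftrightarrow>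
     lower_unitriangular S1 \<and> lower_unitriangular S2 \<and> (\<forall>k. invertible (H k)) \<and>
     M = bm_inv S1 \<odot> bm_diag H \<odot> bm_transpose (bm_inv S2)"

text \<open>Entry \<open>k\<close> of \<open>S \<chi>(x)\<close>, where \<open>\<chi>(x)\<close> has the blocks \<open>x\<^sup>j I\<^sub>p\<close>.\<close>

definition biorth_poly :: "'p::finite bmat \<Rightarrow> nat \<Rightarrow> real \<Rightarrow> real ^ 'p ^ 'p::finite" where
  "biorth_poly S k x = Sum_any (\<lambda>j. S k j ** (x ^ j *\<^sub>R mat 1))"

definition cd_kernel ::
    "'p::finite bmat \<Rightarrow> (nat \<Rightarrow> real ^ 'p ^ 'p) \<Rightarrow> 'p bmat \<Rightarrow> nat \<Rightarrow> real \<Rightarrow> real \<Rightarrow> real ^ 'p ^ 'p::finite" where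
  "cd_kernel S1 H S2 n x y =
     (\<Sum>k\<le>n. transpose (biorth_poly S2 k y) ** matrix_inv (H k) ** biorth_poly S1 k x)"

definition connection_matrix ::
    "'p::finite bmat \<Rightarrow> (real ^ 'p ^ 'p) poly \<Rightarrow> 'p bmat \<Rightarrow> 'p::finite bmat" where
  "connection_matrix S1' W S1 = S1' \<odot> matpoly_shift W \<odot> bm_inv S1"

section \<open>Finite block matrices and truncations\<close>

text \<open>
  A finite block matrix is a function of a row and a column index, read only on finite index sets
  that are passed explicitly. The argument \<open>J\<close> of \<open>blk_mult\<close> is the inner index set. Row and column
  block vectors use \<^typ>\<open>unit\<close> for the trivial index. Truncations index their rows by integers since
  \<open>n - N + 1\<close> may be negative.
\<close>

definition blk_mult ::
    "'j set \<Rightarrow> ('i \<Rightarrow> 'j \<Rightarrow> real ^ 'p ^ 'p) \<Rightarrow> ('j \<Rightarrow> 'k \<Rightarrow> real ^ 'p ^ 'p) \<Rightarrow>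
     ('i \<Rightarrow> 'k \<Rightarrow> real ^ 'p ^ 'p::finite)" where
  "blk_mult J A B = (\<lambda>i k. \<Sum>j\<in>J. A i j ** B j k)"

definition blk_inv :: "'i set \<Rightarrow> ('i \<Rightarrow> 'i \<Rightarrow> real ^ 'p ^ 'p) \<Rightarrow> ('i \<Rightarrow> 'i \<Rightarrow> real ^ 'p ^ 'p::finite)" where
  "blk_inv I A = (SOME B. \<forall>i\<in>I. \<forall>k\<in>I.
     blk_mult I A B i k = (if i = k then mat 1 else 0) \<and>
     blk_mult I B A i k = (if i = k then mat 1 else 0))"

definition trunc_rows :: "nat \<Rightarrow> nat \<Rightarrow> int set" where
  "trunc_rows n N = {int n - int N + 1 .. int n}"

definition trunc_cols :: "nat \<Rightarrow> nat \<Rightarrow> nat set" where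
  "trunc_cols n N = {n + 1 .. n + N}"

definition omega_trunc :: "'p::finite bmat \<Rightarrow> int \<Rightarrow> nat \<Rightarrow> real ^ 'p ^ 'p" where
  "omega_trunc \<omega> = (\<lambda>k l. if k < 0 then 0 else \<omega> (nat k) l)"

definition H_trunc :: "(nat \<Rightarrow> real ^ 'p ^ 'p) \<Rightarrow> int \<Rightarrow> int \<Rightarrow> real ^ 'p ^ 'p" where
  "H_trunc H = (\<lambda>k l. if k = l then (if k < 0 then mat 1 else H (nat k)) else 0)"

definition biorth_row :: "'p::finite bmat \<Rightarrow> real \<Rightarrow> unit \<Rightarrow> int \<Rightarrow> real ^ 'p ^ 'p::finite" where
  "biorth_row S y = (\<lambda>_ k. if k < 0 then 0 else transpose (biorth_poly S (nat k) y))"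

definition biorth_col :: "'p::finite bmat \<Rightarrow> real \<Rightarrow> nat \<Rightarrow> unit \<Rightarrow> real ^ 'p ^ 'p::finite" where
  "biorth_col S x = (\<lambda>l _. biorth_poly S l x)"

section \<open>The inverse of a lower unitriangular matrix is well defined\<close>

lemma mm_zero: "(0::real ^ 'p ^ 'p::finite) ** B = 0" "B ** (0::real ^ 'p ^ 'p) = 0"
  by (simp_all add: vec_eq_iff matrix_matrix_mult_def)

lemma mm_sum_left:
  fixes f :: "'a \<Rightarrow> real ^ 'p ^ 'p::finite"
  shows "(\<Sum>j\<in>J. f j) ** (B :: real ^ 'p ^ 'p) = (\<Sum>j\<in>J. f j ** B)"
proof -
  have add: "(A + C) ** B = A ** B + C ** B" for A C :: "real ^ 'p ^ 'p"
    by (vector matrix_matrix_mult_def sum.distrib distrib_right)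
  show ?thesis
    by (induction J rule: infinite_finite_induct) (simp_all add: mm_zero add)
qed

lemma mm_sum_right: "(B::real ^ 'p ^ 'p::finite) ** (\<Sum>j\<in>J. f j) = (\<Sum>j\<in>J. B ** f j)"
  by (induction J rule: infinite_finite_induct) (simp_all add: mm_zero matrix_add_ldistrib)

lemma bm_mult_lower:
  fixes A B :: "'p::finite bmat"
  assumes "\<forall>i j. i < j \<longrightarrow> A i j = 0"
  shows "(A \<odot> B) i k = (\<Sum>j\<le>i. A i j ** B j k)"
  unfolding bm_mult_def
proof (rule Sum_any.expand_superset)
  show "{j. A i j ** B j k \<noteq> 0} \<subseteq> {..i}"
    using assms by (auto simp: mm_zero not_less[symmetric])
qed simp

lemma bm_mult_assoc_lower:
  fixes A B C :: "'p::finite bmat"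
  assumes A: "\<forall>i j. i < j \<longrightarrow> A i j = 0" and B: "\<forall>i j. i < j \<longrightarrow> B i j = 0"
  shows "A \<odot> B \<odot> C = A \<odot> (B \<odot> C)"
proof (intro ext)
  fix i k
  have AB: "\<forall>i j. i < j \<longrightarrow> (A \<odot> B) i j = 0"
    using B by (auto simp: bm_mult_lower[OF A] mm_zero intro!: sum.neutral)
  have "(A \<odot> B \<odot> C) i k = (\<Sum>j\<le>i. \<Sum>l\<le>i. A i l ** B l j ** C j k)"
    unfolding bm_mult_lower[OF AB] bm_mult_lower[OF A] by (simp add: mm_sum_left)
  also have "\<dots> = (\<Sum>l\<le>i. \<Sum>j\<le>i. A i l ** B l j ** C j k)"
    by (rule sum.swap)
  also have "\<dots> = (\<Sum>l\<le>i. \<Sum>j\<le>l. A i l ** B l j ** C j k)"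
    using B by (intro sum.cong refl sum.mono_neutral_right) (auto simp: mm_zero)
  also have "\<dots> = (A \<odot> (B \<odot> C)) i k"
    unfolding bm_mult_lower[OF A] bm_mult_lower[OF B]
    by (simp add: mm_sum_right matrix_mul_assoc)
  finally show "(A \<odot> B \<odot> C) i k = (A \<odot> (B \<odot> C)) i k" .
qed

lemma lower_unitriangularD:
  assumes "lower_unitriangular S"
  shows "S i i = mat 1" "\<forall>i j. i < j \<longrightarrow> S i j = 0"
  using assms by (auto simp: lower_unitriangular_def)

lemma bm_mult_one_left: "bm_one \<odot> A = (A :: 'p::finite bmat)"
proof (intro ext)
  fix i k
  have "(bm_one \<odot> A) i k = (\<Sum>j\<le>i. (if i = j then mat 1 else 0) ** A j k)"
    by (subst bm_mult_lower) (auto simp: bm_one_def bm_diag_def)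
  also have "\<dots> = (\<Sum>j\<le>i. if i = j then A j k else 0)"
    by (intro sum.cong refl) (auto simp: mm_zero)
  finally show "(bm_one \<odot> A) i k = A i k" by simp
qed

lemma bm_mult_one_right:
  assumes "\<forall>i j. i < j \<longrightarrow> A i j = 0"
  shows "A \<odot> bm_one = A"
proof (intro ext)
  fix i k
  have "(A \<odot> bm_one) i k = (\<Sum>j\<le>i. if j = k then A i j else 0)"
    unfolding bm_mult_lower[OF assms]
    by (intro sum.cong refl) (auto simp: mm_zero bm_one_def bm_diag_def)
  then show "(A \<odot> bm_one) i k = A i k" using assms by auto
qed

function bm_right_inv :: "'p::finite bmat \<Rightarrow> 'p bmat" where
  "bm_right_inv S i k =
     (if i < k then 0 else if i = k then mat 1
      else - (\<Sum>j\<in>{..<i}. S i j ** bm_right_inv S j k))"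
  by pat_completeness auto
termination by (relation "Wellfounded.measure (\<lambda>(S, i, k). i)") auto

declare bm_right_inv.simps [simp del]

lemma bm_right_inv:
  fixes S :: "'p::finite bmat"
  assumes S: "lower_unitriangular S"
  shows "lower_unitriangular (bm_right_inv S)" "S \<odot> bm_right_inv S = bm_one"
proof -
  let ?T = "bm_right_inv S"
  show T: "lower_unitriangular ?T"
    by (auto simp: lower_unitriangular_def bm_right_inv.simps)
  show "S \<odot> ?T = bm_one"
  proof (intro ext)
    fix i k
    have "(S \<odot> ?T) i k = (\<Sum>j\<le>i. S i j ** ?T j k)"
      by (rule bm_mult_lower[OF lower_unitriangularD(2)[OF S]])
    also have "\<dots> = (\<Sum>j<i. S i j ** ?T j k) + ?T i k"
      by (simp add: lessThan_Suc_atMost[symmetric] lower_unitriangularD(1)[OF S])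
    also have "\<dots> = bm_one i k"
    proof (cases "k < i")
      case True
      then show ?thesis by (simp add: bm_right_inv.simps[of S i k] bm_one_def bm_diag_def)
    next
      case False
      then have "(\<Sum>j<i. S i j ** ?T j k) = 0"
        by (intro sum.neutral) (auto simp: mm_zero lower_unitriangularD(2)[OF T])
      then show ?thesis using False by (auto simp: bm_right_inv.simps[of S i k] bm_one_def bm_diag_def)
    qed
    finally show "(S \<odot> ?T) i k = bm_one i k" .
  qed
qed

lemma bm_inv:
  fixes S :: "'p::finite bmat"
  assumes S: "lower_unitriangular S"
  shows "lower_unitriangular (bm_inv S)" "S \<odot> bm_inv S = bm_one" "bm_inv S \<odot> S = bm_one"
proof -
  let ?T = "bm_right_inv S"
  let ?P = "\<lambda>T. lower_unitriangular T \<and> S \<odot> T = bm_one \<and> T \<odot> S = bm_one"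
  note T = bm_right_inv[OF S]
  let ?U = "bm_right_inv ?T"
  note U = bm_right_inv[OF T(1)]
  note lo = lower_unitriangularD(2)
  have "S = S \<odot> (?T \<odot> ?U)"
    by (simp add: U bm_mult_one_right lo[OF S])
  also have "\<dots> = ?U"
    by (subst bm_mult_assoc_lower[symmetric]) (simp_all add: lo[OF S] lo[OF T(1)] T bm_mult_one_left)
  finally have "?T \<odot> S = bm_one" using U(2) by simp
  then have PT: "?P ?T" using T by simp
  have uniq: "T' = ?T" if "?P T'" for T'
  proof -
    have "T' = T' \<odot> (S \<odot> ?T)" using that by (simp add: T bm_mult_one_right lo)
    also have "\<dots> = ?T"
      using that by (subst bm_mult_assoc_lower[symmetric]) (simp_all add: lo lo[OF S] bm_mult_one_left)
    finally show ?thesis .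
  qed
  have "?P (bm_inv S)" unfolding bm_inv_def by (rule theI[of ?P, OF PT uniq])
  then show "lower_unitriangular (bm_inv S)" "S \<odot> bm_inv S = bm_one" "bm_inv S \<odot> S = bm_one"
    by auto
qed

end

theory Submission
  imports Defs
begin

text \<open>
  Since the perturbed moment matrix is \<open>W(\<Lambda>) M\<close>, the two factorizations express the connection
  matrix \<open>\<omega> = S1' W(\<Lambda>) S1\<^sup>-\<^sup>1\<close> also as \<open>H' (S2 S2'\<^sup>-\<^sup>1)\<^sup>T H\<^sup>-\<^sup>1\<close>. The first form gives
  \<open>\<omega> P\<^sup>[\<^sup>1\<^sup>](x) = P'\<^sup>[\<^sup>1\<^sup>](x) W(x)\<close> and the upper band \<open>l \<le> k + N\<close>. The second one gives
  \<open>\<Sum>k\<le>l. P'\<^sup>[\<^sup>2\<^sup>]\<^sub>k(y)\<^sup>T H'\<^sub>k\<^sup>-\<^sup>1 \<omega>\<^sub>k\<^sub>l = P\<^sup>[\<^sup>2\<^sup>]\<^sub>l(y)\<^sup>T H\<^sub>l\<^sup>-\<^sup>1\<close> and the lower bound \<open>k \<le> l\<close>. In the double sum of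
  \<open>P'\<^sup>[\<^sup>2\<^sup>]\<^sub>k(y)\<^sup>T H'\<^sub>k\<^sup>-\<^sup>1 \<omega>\<^sub>k\<^sub>l P\<^sup>[\<^sup>1\<^sup>]\<^sub>l(x)\<close> over \<open>k \<le> n\<close> and all \<open>l\<close>, the terms with \<open>l \<le> n\<close> add up to
  the unperturbed kernel and the terms with \<open>n < l\<close> to the correction.
\<close>

section \<open>Row-finite block matrices\<close>

text \<open>Products of semi-infinite matrices need not associate. Row-finiteness is preserved by
  products and covers both lower triangular matrices and \<open>W(\<Lambda>)\<close>.\<close>

definition row_finite :: "'p::finite bmat \<Rightarrow> bool" where
  "row_finite A \<longleftrightarrow> (\<forall>i. finite {j. A i j \<noteq> 0})"

lemma bm_mult_superset:
  fixes A B :: "'p::finite bmat"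
  assumes "finite J" "\<And>j. j \<notin> J \<Longrightarrow> A i j = 0"
  shows "(A \<odot> B) i k = (\<Sum>j\<in>J. A i j ** B j k)"
  unfolding bm_mult_def
  by (rule Sum_any.expand_superset) (use assms in \<open>auto intro: ccontr simp: mm_zero\<close>)

lemma row_finite_lower:
  assumes "\<forall>i j. i < j \<longrightarrow> A i j = 0"
  shows "row_finite (A :: 'p::finite bmat)"
  unfolding row_finite_def
proof
  fix i
  show "finite {j. A i j \<noteq> 0}"
    by (rule finite_subset[of _ "{..i}"]) (use assms in \<open>auto simp: not_less[symmetric]\<close>)
qed

lemma bm_mult_support:
  fixes A B :: "'p::finite bmat"
  assumes "row_finite A"
  shows "{k. (A \<odot> B) i k \<noteq> 0} \<subseteq> (\<Union>j\<in>{j. A i j \<noteq> 0}. {k. B j k \<noteq> 0})"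
proof -
  have "(A \<odot> B) i k = (\<Sum>j\<in>{j. A i j \<noteq> 0}. A i j ** B j k)" for k
    by (rule bm_mult_superset) (use assms in \<open>auto simp: row_finite_def\<close>)
  then show ?thesis
    by (auto simp: mm_zero elim!: sum.not_neutral_contains_not_neutral)
qed

lemma row_finite_mult:
  fixes A B :: "'p::finite bmat"
  assumes "row_finite A" "row_finite B"
  shows "row_finite (A \<odot> B)"
  unfolding row_finite_def
  by (intro allI finite_subset[OF bm_mult_support[OF assms(1)]])
     (use assms in \<open>auto simp: row_finite_def\<close>)

text \<open>From row \<open>i\<close>, the rows of \<open>A\<close> and then of \<open>B\<close>
  reach only finitely many indices, so the two sums can be swapped. Hence \<open>C\<close> is
  arbitrary and may be an upper triangular last factor.\<close>

lemma bm_mult_assoc: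
  fixes A B C :: "'p::finite bmat"
  assumes A: "row_finite A" and B: "row_finite B"
  shows "A \<odot> B \<odot> C = A \<odot> (B \<odot> C)"
proof (intro ext)
  fix i k
  let ?L = "{l. A i l \<noteq> 0}"
  let ?J = "\<Union>l\<in>?L. {j. B l j \<noteq> 0}"
  have fin: "finite ?L" "finite ?J"
    using A B by (auto simp: row_finite_def)
  have "(A \<odot> B \<odot> C) i k = (\<Sum>j\<in>?J. (A \<odot> B) i j ** C j k)"
    by (rule bm_mult_superset) (use fin bm_mult_support[OF A] in blast)+
  also have "\<dots> = (\<Sum>j\<in>?J. \<Sum>l\<in>?L. A i l ** B l j ** C j k)"
    using fin by (intro sum.cong refl) (subst bm_mult_superset[of ?L], auto simp: mm_sum_left)
  also have "\<dots> = (\<Sum>l\<in>?L. \<Sum>j\<in>?J. A i l ** B l j ** C j k)"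
    by (rule sum.swap)
  also have "\<dots> = (\<Sum>l\<in>?L. A i l ** (B \<odot> C) l k)"
  proof (intro sum.cong refl)
    fix l assume l: "l \<in> ?L"
    have "(B \<odot> C) l k = (\<Sum>j\<in>?J. B l j ** C j k)"
      by (rule bm_mult_superset) (use fin l in auto)
    then show "(\<Sum>j\<in>?J. A i l ** B l j ** C j k) = A i l ** (B \<odot> C) l k"
      by (simp add: mm_sum_right matrix_mul_assoc)
  qed
  also have "\<dots> = (A \<odot> (B \<odot> C)) i k"
    by (rule bm_mult_superset[symmetric]) (use fin in auto)
  finally show "(A \<odot> B \<odot> C) i k = (A \<odot> (B \<odot> C)) i k" .
qed

section \<open>Transposes, diagonal matrices and polynomials in the shift\<close>

lemma transpose_zero: "transpose (0 :: real ^ 'p ^ 'p) = 0"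
  by (simp add: transpose_def vec_eq_iff)

lemma transpose_eq_zero_iff: "transpose (A :: real ^ 'p ^ 'p) = 0 \<longleftrightarrow> A = 0"
  by (metis transpose_transpose transpose_zero)

lemma transpose_sum:
  "transpose (\<Sum>j\<in>J. f j :: real ^ 'p ^ 'p) = (\<Sum>j\<in>J. transpose (f j))"
  by (simp add: transpose_def vec_eq_iff)

text \<open>Transposition keeps the set of nonzero summands, so both \<open>Sum_any\<close> agree
  even where that set is infinite and they default to 0.\<close>

lemma bm_transpose_mult:
  "bm_transpose (A \<odot> B) = bm_transpose B \<odot> bm_transpose (A :: 'p::finite bmat)"
  by (intro ext)
     (simp add: bm_transpose_def bm_mult_def Sum_any.expand_set matrix_transpose_mul[symmetric]
        transpose_sum transpose_eq_zero_iff)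

lemma bm_transpose_transpose: "bm_transpose (bm_transpose A) = A"
  by (simp add: bm_transpose_def)

lemma bm_mult_diag_right: "(A \<odot> bm_diag D) i k = A i k ** D k"
  unfolding bm_mult_def bm_diag_def
  by (subst Sum_any.expand_superset[of "{k}"]) (auto simp: mm_zero split: if_splits)

lemma bm_mult_diag_left: "(bm_diag D \<odot> A) i k = D i ** A i k"
  by (subst bm_mult_superset[of "{i}"]) (auto simp: bm_diag_def)

lemma row_finite_diag: "row_finite (bm_diag D)"
  by (rule row_finite_lower) (simp add: bm_diag_def)

lemma bm_power_shift:
  "bm_power shift_matrix j i k = (if k = i + j then mat 1 else 0 :: real ^ 'p ^ 'p::finite)"
proof (induction j arbitrary: i)
  case (Suc j)
  have "(shift_matrix \<odot> bm_power shift_matrix j) i k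
      = (\<Sum>l\<in>{Suc i}. shift_matrix i l ** bm_power shift_matrix j l k :: real ^ 'p ^ 'p)"
    by (rule bm_mult_superset) (auto simp: shift_matrix_def)
  moreover have "shift_matrix i (Suc i) = (mat 1 :: real ^ 'p ^ 'p)"
    by (simp add: shift_matrix_def)
  ultimately show ?case by (simp add: Suc)
qed (simp add: bm_one_def bm_diag_def)

lemma matpoly_shift_entry:
  "matpoly_shift W i k = (if i \<le> k then coeff W (k - i) else 0 :: real ^ 'p ^ 'p::finite)"
proof -
  have "matpoly_shift W i k = (\<Sum>j\<le>degree W. if j = k - i \<and> i \<le> k then coeff W j else 0)"
    unfolding matpoly_shift_def bm_mult_diag_left bm_power_shift
    by (intro sum.cong refl) (auto simp: mm_zero)
  also have "\<dots> = (if i \<le> k then coeff W (k - i) else 0)"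
    by (auto simp: coeff_eq_0)
  finally show ?thesis .
qed

lemma matpoly_shift_mult:
  "(matpoly_shift W \<odot> B) i k = (\<Sum>j\<le>degree W. coeff W j ** B (i + j) (k::nat) :: real ^ 'p ^ 'p::finite)"
proof -
  have "(matpoly_shift W \<odot> B) i k = (\<Sum>l\<in>(+) i ` {..degree W}. matpoly_shift W i l ** B l k)"
  proof (rule bm_mult_superset)
    fix l assume l: "l \<notin> (+) i ` {..degree W}"
    have "l = i + (l - i)" if "i \<le> l" using that by simp
    then have "degree W < l - i" if "i \<le> l" using that l by (metis atMost_iff imageI not_le)
    then show "matpoly_shift W i l = 0" by (auto simp: matpoly_shift_entry coeff_eq_0)
  qed simp
  also have "\<dots> = (\<Sum>j\<le>degree W. coeff W j ** B (i + j) k)"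
    by (subst sum.reindex) (auto simp: matpoly_shift_entry)
  finally show ?thesis .
qed

lemma row_finite_matpoly_shift: "row_finite (matpoly_shift (W :: (real ^ 'p ^ 'p::finite) poly))"
  unfolding row_finite_def
proof
  fix i
  show "finite {j. matpoly_shift W i j \<noteq> 0}"
    by (rule finite_subset[of _ "{..i + degree W}"])
       (auto simp: matpoly_shift_entry dest!: le_degree split: if_splits)
qed

section \<open>Moments\<close>

lemma signed_integral_sum_moments:
  fixes \<mu> :: "signed_measure ^ 'p ^ 'p::finite" and f :: "'i \<Rightarrow> real"
  assumes "finite_moments \<mu>"
  shows "signed_integral (\<mu> $ a $ b) (\<lambda>x. \<Sum>l\<in>L. f l * x ^ e l)
    = (\<Sum>l\<in>L. f l * moment \<mu> (e l) $ a $ b)"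
proof -
  have "integrable (fst (\<mu> $ a $ b)) (\<lambda>x. x ^ n)" "integrable (snd (\<mu> $ a $ b)) (\<lambda>x. x ^ n)" for n
    using assms by (auto simp: finite_moments_def)
  then show ?thesis
    by (simp add: signed_integral_def moment_def sum_subtractf[symmetric] right_diff_distrib)
qed

text \<open>The coefficient of \<open>x^l\<close> in \<open>W\<close> contributes the moment of
  order \<open>i + l + j\<close>, that is, row \<open>i + l\<close> of the moment matrix, which is
  how \<open>\<Lambda>^l\<close> acts. Past this identity only matrix algebra remains.\<close>

lemma perturbed_moment_matrix_eq:
  fixes \<mu> :: "signed_measure ^ 'p ^ 'p::finite"
  assumes "finite_moments \<mu>"
  shows "perturbed_moment_matrix W \<mu> = matpoly_shift W \<odot> moment_matrix \<mu>"
proof (intro ext, unfold vec_eq_iff, intro allI)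
  fix i j a b
  have "perturbed_moment_matrix W \<mu> i j $ a $ b
      = (\<Sum>c\<in>UNIV. signed_integral (\<mu> $ c $ b)
          (\<lambda>x. \<Sum>l\<le>degree W. coeff W l $ a $ c * x ^ (i + l + j)))"
    by (simp add: perturbed_moment_matrix_def mat_integral_def matpoly_eval_def sum_distrib_left
        power_add algebra_simps)
  also have "\<dots> = (\<Sum>c\<in>UNIV. \<Sum>l\<le>degree W. coeff W l $ a $ c * moment \<mu> (i + l + j) $ c $ b)"
    by (simp only: signed_integral_sum_moments[OF assms])
  also have "\<dots> = (\<Sum>l\<le>degree W. \<Sum>c\<in>UNIV. coeff W l $ a $ c * moment \<mu> (i + l + j) $ c $ b)"
    by (rule sum.swap)
  also have "\<dots> = (matpoly_shift W \<odot> moment_matrix \<mu>) i j $ a $ b"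
    by (simp add: matpoly_shift_mult moment_matrix_def matrix_matrix_mult_def)
  finally show "perturbed_moment_matrix W \<mu> i j $ a $ b
      = (matpoly_shift W \<odot> moment_matrix \<mu>) i j $ a $ b" .
qed

section \<open>The connection matrix\<close>

lemma row_finite_connection_matrix:
  assumes "lower_unitriangular S1" "lower_unitriangular S1'"
  shows "row_finite (connection_matrix S1' W S1)"
  unfolding connection_matrix_def using assms
  by (intro row_finite_mult row_finite_matpoly_shift row_finite_lower lower_unitriangularD bm_inv)

text \<open>Only \<open>W(\<Lambda>)\<close> can raise the column index, by at most
  \<open>degree W\<close>; the other two factors are lower triangular.\<close>

lemma connection_matrix_support:
  fixes S1 S1' :: "'p::finite bmat"
  assumes "lower_unitriangular S1" "lower_unitriangular S1'" "k + degree W < l"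
  shows "connection_matrix S1' W S1 k l = 0"
proof -
  have "connection_matrix S1' W S1 = S1' \<odot> (matpoly_shift W \<odot> bm_inv S1)"
    unfolding connection_matrix_def using assms
    by (intro bm_mult_assoc row_finite_matpoly_shift row_finite_lower lower_unitriangularD)
  then have "connection_matrix S1' W S1 k l
      = (\<Sum>i\<le>k. S1' k i ** (\<Sum>j\<le>degree W. coeff W j ** bm_inv S1 (i + j) l))"
    using assms by (simp add: bm_mult_lower[OF lower_unitriangularD(2)] matpoly_shift_mult)
  also have "\<dots> = 0"
    using assms lower_unitriangularD(2)[OF bm_inv(1)[OF assms(1)]]
    by (intro sum.neutral ballI) (auto simp: mm_zero)
  finally show ?thesis .
qed

text \<open>Entrywise form of \<open>\<omega> H = H' (S2 S2'\<^sup>-\<^sup>1)\<^sup>T\<close>,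
  transposed: the factorization of \<open>M\<close> is inserted into that of
  \<open>W(\<Lambda>) M\<close> and the outer factors are cancelled.\<close>

lemma connection_matrix_transpose_diag:
  fixes M S1 S2 S1' S2' :: "'p::finite bmat"
  assumes "gauss_borel M S1 H S2" "gauss_borel (matpoly_shift W \<odot> M) S1' H' S2'"
  shows "transpose (connection_matrix S1' W S1 k l ** H l)
    = (S2 \<odot> bm_inv S2') l k ** transpose (H' k)"
proof -
  have tri: "lower_unitriangular S1" "lower_unitriangular S2"
      "lower_unitriangular S1'" "lower_unitriangular S2'"
    and M: "M = bm_inv S1 \<odot> bm_diag H \<odot> bm_transpose (bm_inv S2)"
    and M': "matpoly_shift W \<odot> M = bm_inv S1' \<odot> bm_diag H' \<odot> bm_transpose (bm_inv S2')"
    using assms by (auto simp: gauss_borel_def)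
  note rf = row_finite_mult row_finite_matpoly_shift row_finite_diag
    row_finite_lower[OF lower_unitriangularD(2)] bm_inv(1) tri
  let ?\<omega> = "connection_matrix S1' W S1"
  \<comment> \<open>The upper triangular factor stays last, so associativity for row-finite left
    factors suffices.\<close>
  have "?\<omega> \<odot> bm_diag H \<odot> bm_transpose (bm_inv S2) = S1' \<odot> (matpoly_shift W \<odot> M)"
    unfolding M connection_matrix_def by (simp add: bm_mult_assoc rf)
  also have "\<dots> = S1' \<odot> bm_inv S1' \<odot> bm_diag H' \<odot> bm_transpose (bm_inv S2')"
    unfolding M' by (simp add: bm_mult_assoc rf)
  also have "\<dots> = bm_diag H' \<odot> bm_transpose (bm_inv S2')"
    by (simp add: bm_inv tri bm_mult_one_left)
  \<comment> \<open>Multiplying by the upper triangular \<open>S2\<^sup>T\<close> on the right is not covered by associativity of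
    row-finite matrices, hence the passage to the transpose.\<close>
  finally have "bm_inv S2 \<odot> bm_transpose (?\<omega> \<odot> bm_diag H)
      = bm_inv S2' \<odot> bm_transpose (bm_diag H')"
    by (metis bm_transpose_mult bm_transpose_transpose)
  then have "S2 \<odot> bm_inv S2 \<odot> bm_transpose (?\<omega> \<odot> bm_diag H)
      = S2 \<odot> bm_inv S2' \<odot> bm_transpose (bm_diag H')"
    by (simp add: bm_mult_assoc rf)
  then have "bm_transpose (?\<omega> \<odot> bm_diag H) = S2 \<odot> bm_inv S2' \<odot> bm_transpose (bm_diag H')"
    by (simp add: bm_inv tri bm_mult_one_left)
  moreover have "bm_transpose (bm_diag H') = bm_diag (\<lambda>k. transpose (H' k))"
    by (intro ext) (auto simp: bm_transpose_def bm_diag_def transpose_zero)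
  ultimately have "bm_transpose (?\<omega> \<odot> bm_diag H) l k
      = (S2 \<odot> bm_inv S2' \<odot> bm_diag (\<lambda>k. transpose (H' k))) l k"
    by simp
  then show ?thesis by (simp add: bm_mult_diag_right bm_transpose_def)
qed

section \<open>Bi-orthogonal polynomials under a change of triangular factor\<close>

text \<open>The block column \<open>\<chi>(x)\<close>, repeated in every column so that it is again a block matrix.\<close>

definition monomial_column :: "real \<Rightarrow> 'p::finite bmat" where
  "monomial_column x = (\<lambda>j _. x ^ j *\<^sub>R mat 1)"

text \<open>The column \<open>c\<close> is free because \<open>monomial_column\<close> has equal
  columns; later proofs fix \<open>c = 0\<close>.\<close>

lemma biorth_poly_eq_mult: "biorth_poly S k x = (S \<odot> monomial_column x) k c"
  by (simp add: biorth_poly_def bm_mult_def monomial_column_def)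

text \<open>Insert \<open>bm_inv T \<odot> T\<close> between \<open>S\<close> and
  \<open>\<chi>(y)\<close>; triangularity of \<open>S \<odot> bm_inv T\<close> ends the sum at
  \<open>l\<close>.\<close>

lemma biorth_poly_change:
  fixes S T :: "'p::finite bmat"
  assumes S: "lower_unitriangular S" and T: "lower_unitriangular T"
  shows "biorth_poly S l y = (\<Sum>k\<le>l. (S \<odot> bm_inv T) l k ** biorth_poly T k y)"
proof -
  note lo = lower_unitriangularD(2)
  have low: "\<forall>i j. i < j \<longrightarrow> (S \<odot> bm_inv T) i j = 0"
    by (auto simp: bm_mult_lower[OF lo[OF S]] mm_zero lo[OF bm_inv(1)[OF T]] intro!: sum.neutral)
  have "S \<odot> bm_inv T \<odot> (T \<odot> monomial_column y) = S \<odot> (bm_inv T \<odot> T \<odot> monomial_column y)"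
    by (simp add: bm_mult_assoc row_finite_mult row_finite_lower[OF lo] S T bm_inv(1))
  also have "\<dots> = S \<odot> monomial_column y"
    by (simp add: bm_inv T bm_mult_one_left)
  finally show ?thesis
    by (simp add: biorth_poly_eq_mult[where c=0] bm_mult_lower[OF low, symmetric])
qed

lemma connection_matrix_biorth_poly:
  fixes S1 S1' :: "'p::finite bmat"
  assumes S: "lower_unitriangular S1" and S': "lower_unitriangular S1'"
  shows "(\<Sum>l\<le>k + degree W. connection_matrix S1' W S1 k l ** biorth_poly S1 l x)
    = biorth_poly S1' k x ** matpoly_eval W x"
proof -
  note rf = row_finite_mult row_finite_matpoly_shift row_finite_connection_matrix
    row_finite_lower[OF lower_unitriangularD(2)] bm_inv(1) S S'
  let ?X = "monomial_column x :: 'p bmat"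
  \<comment> \<open>\<open>\<chi>(x)\<close> is an eigenvector,
    \<open>\<Lambda> \<chi>(x) = x \<chi>(x)\<close>, and its scalar blocks commute with the
    coefficients of \<open>W\<close>.\<close>
  have WX: "(matpoly_shift W \<odot> ?X) i 0 = ?X i 0 ** matpoly_eval W x" for i
    by (simp add: matpoly_shift_mult monomial_column_def matpoly_eval_def mm_sum_right
        scaleR_right.sum power_add vec_eq_iff matrix_matrix_mult_def mat_def
        if_distrib if_distribR sum_distrib_left mult_ac cong: if_cong)
  have "(\<Sum>l\<le>k + degree W. connection_matrix S1' W S1 k l ** biorth_poly S1 l x)
      = (connection_matrix S1' W S1 \<odot> (S1 \<odot> ?X)) k 0"
    by (subst bm_mult_superset[of "{..k + degree W}"])
       (auto simp: connection_matrix_support[OF S S'] biorth_poly_eq_mult[where c=0])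
  also have "connection_matrix S1' W S1 \<odot> (S1 \<odot> ?X)
      = S1' \<odot> (matpoly_shift W \<odot> (bm_inv S1 \<odot> S1 \<odot> ?X))"
    unfolding connection_matrix_def by (simp add: bm_mult_assoc rf)
  also have "\<dots> = S1' \<odot> (matpoly_shift W \<odot> ?X)"
    by (simp add: bm_inv S bm_mult_one_left)
  also have "\<dots> k 0 = (S1' \<odot> ?X) k 0 ** matpoly_eval W x"
    by (simp add: bm_mult_lower[OF lower_unitriangularD(2)[OF S']] WX mm_sum_left matrix_mul_assoc)
  finally show ?thesis by (simp add: biorth_poly_eq_mult[where c=0])
qed

section \<open>Truncation\<close>

lemma invertible_mat_1: "invertible (mat 1 :: real ^ 'p ^ 'p)"
  by (metis invertible_def matrix_mul_lid)

lemma matrix_inv: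
  fixes A :: "real ^ 'p ^ 'p"
  assumes "invertible A"
  shows "A ** matrix_inv A = mat 1" "matrix_inv A ** A = mat 1"
  using someI_ex[OF assms[unfolded invertible_def]] by (simp_all add: matrix_inv_def)

text \<open>As \<open>blk_inv\<close> is a choice, two facts are needed: the diagonal of inverses
  meets the specification, and every matrix meeting it agrees with that diagonal on
  \<open>I\<close>.\<close>

lemma blk_inv_diag:
  fixes A :: "'i \<Rightarrow> 'i \<Rightarrow> real ^ 'p ^ 'p::finite"
  assumes I: "finite I" and diag: "\<And>i k. i \<noteq> k \<Longrightarrow> A i k = 0" and inv: "\<And>i. invertible (A i i)"
    and "i \<in> I" "k \<in> I"
  shows "blk_inv I A i k = (if i = k then matrix_inv (A i i) else 0)"
proof -
  let ?P = "\<lambda>B. \<forall>i\<in>I. \<forall>k\<in>I. blk_mult I A B i k = (if i = k then mat 1 else 0) \<and>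
     blk_mult I B A i k = (if i = k then mat 1 else 0)"
  have l: "blk_mult I A B i k = A i i ** B i k" if "i \<in> I" for B and i k
  proof -
    have "blk_mult I A B i k = (\<Sum>j\<in>I. if j = i then A i j ** B j k else 0)"
      unfolding blk_mult_def using diag by (intro sum.cong) (auto simp: mm_zero)
    then show ?thesis using I that by simp
  qed
  have r: "blk_mult I B A i k = B i k ** A k k" if "k \<in> I" for B and i k
  proof -
    have "blk_mult I B A i k = (\<Sum>j\<in>I. if j = k then B i j ** A j k else 0)"
      unfolding blk_mult_def using diag by (intro sum.cong) (auto simp: mm_zero)
    then show ?thesis using I that by simp
  qed
  have "?P (\<lambda>i k. if i = k then matrix_inv (A i i) else 0)"
    using inv by (auto simp: l r matrix_inv mm_zero)
  then have "?P (blk_inv I A)"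
    unfolding blk_inv_def by (rule someI[where P = ?P])
  then have AB: "A i i ** blk_inv I A i k = (if i = k then mat 1 else 0)"
    using assms(4,5) l[of i "blk_inv I A" k] by simp
  have "blk_inv I A i k = matrix_inv (A i i) ** A i i ** blk_inv I A i k"
    by (simp add: matrix_inv(2)[OF inv])
  also have "\<dots> = matrix_inv (A i i) ** (if i = k then mat 1 else 0)"
    by (simp only: matrix_mul_assoc[symmetric] AB)
  finally show ?thesis by (simp add: mm_zero)
qed

text \<open>Passes from integer rows to natural ones. Rows \<open>k < 0\<close> contribute 0, and
  \<open>n < k + N\<close> is \<open>n - N + 1 \<le> k\<close> without truncated
  subtraction.\<close>

lemma truncated_term_eq:
  fixes H :: "nat \<Rightarrow> real ^ 'p ^ 'p::finite"
  assumes H: "\<And>k. invertible (H k)"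
  shows "blk_mult (trunc_cols n N)
        (blk_mult (trunc_rows n N)
          (blk_mult (trunc_rows n N) (biorth_row S y) (blk_inv (trunc_rows n N) (H_trunc H)))
          (omega_trunc \<omega>))
        (biorth_col T x) () ()
    = (\<Sum>l\<in>{n + 1..n + N}. \<Sum>k | k \<le> n \<and> n < k + N.
        transpose (biorth_poly S k y) ** matrix_inv (H k) ** \<omega> k l ** biorth_poly T l x)"
proof -
  let ?I = "trunc_rows n N"
  have row: "blk_mult ?I (biorth_row S y) (blk_inv ?I (H_trunc H)) () k
      = (if k < 0 then 0 else transpose (biorth_poly S (nat k) y) ** matrix_inv (H (nat k)))"
    if k: "k \<in> ?I" for k
  proof -
    have "blk_inv ?I (H_trunc H) i k = (if i = k then matrix_inv (H_trunc H i i) else 0)"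
      if "i \<in> ?I" for i
      by (rule blk_inv_diag)
         (use k that H in \<open>auto simp: trunc_rows_def H_trunc_def invertible_mat_1\<close>)
    then have "blk_mult ?I (biorth_row S y) (blk_inv ?I (H_trunc H)) () k
      = (\<Sum>i\<in>?I. if i = k then biorth_row S y () i ** matrix_inv (H_trunc H i i) else 0)"
      unfolding blk_mult_def by (intro sum.cong) (auto simp: mm_zero)
    also have "\<dots> = biorth_row S y () k ** matrix_inv (H_trunc H k k)"
      using k by (simp add: trunc_rows_def)
    finally show ?thesis by (simp add: biorth_row_def H_trunc_def mm_zero)
  qed
  have "blk_mult ?I (blk_mult ?I (biorth_row S y) (blk_inv ?I (H_trunc H))) (omega_trunc \<omega>) () l
      = (\<Sum>k | k \<le> n \<and> n < k + N. transpose (biorth_poly S k y) ** matrix_inv (H k) ** \<omega> k l)"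
    for l
  proof -
    have "blk_mult ?I (blk_mult ?I (biorth_row S y) (blk_inv ?I (H_trunc H))) (omega_trunc \<omega>) () l
      = (\<Sum>k\<in>?I. if k < 0 then 0 else
          transpose (biorth_poly S (nat k) y) ** matrix_inv (H (nat k)) ** \<omega> (nat k) l)"
      unfolding blk_mult_def[where J="?I" and B="omega_trunc \<omega>"]
      by (intro sum.cong) (auto simp: row mm_zero omega_trunc_def)
    also have "\<dots> = (\<Sum>k\<in>int ` {k. k \<le> n \<and> n < k + N}. if k < 0 then 0 else
          transpose (biorth_poly S (nat k) y) ** matrix_inv (H (nat k)) ** \<omega> (nat k) l)"
    proof (rule sum.mono_neutral_right)
      show "\<forall>k\<in>?I - int ` {k. k \<le> n \<and> n < k + N}. (if k < 0 then 0 else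
          transpose (biorth_poly S (nat k) y) ** matrix_inv (H (nat k)) ** \<omega> (nat k) l) = 0"
      proof
        fix k assume k: "k \<in> ?I - int ` {k. k \<le> n \<and> n < k + N}"
        have "k < 0"
        proof (rule ccontr)
          assume "\<not> k < 0"
          then have "k = int (nat k)" "nat k \<in> {k. k \<le> n \<and> n < k + N}"
            using k by (auto simp: trunc_rows_def)
          then show False using k by blast
        qed
        then show "(if k < 0 then 0 else
          transpose (biorth_poly S (nat k) y) ** matrix_inv (H (nat k)) ** \<omega> (nat k) l) = 0"
          by simp
      qed
    qed (auto simp: trunc_rows_def)
    finally show ?thesis by (simp add: sum.reindex)
  qed
  then show ?thesis
    unfolding blk_mult_def[of "trunc_cols n N"]
    by (simp add: trunc_cols_def biorth_col_def mm_sum_left)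
qed

lemma cd_kernel_connection:
  fixes S1 S2 S1' S2' M :: "'p::finite bmat"
  assumes gb: "gauss_borel M S1 H S2" "gauss_borel (matpoly_shift W \<odot> M) S1' H' S2'"
  defines "\<omega> \<equiv> connection_matrix S1' W S1"
  shows "cd_kernel S1' H' S2' n x y ** matpoly_eval W x = cd_kernel S1 H S2 n x y +
    (\<Sum>l\<in>{n + 1..n + degree W}. \<Sum>k | k \<le> n \<and> n < k + degree W.
        transpose (biorth_poly S2' k y) ** matrix_inv (H' k) ** \<omega> k l ** biorth_poly S1 l x)"
proof -
  let ?N = "degree W"
  have tri: "lower_unitriangular S1" "lower_unitriangular S2"
      "lower_unitriangular S1'" "lower_unitriangular S2'"
    and inv: "\<And>k. invertible (H k)" "\<And>k. invertible (H' k)"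
    using gb by (auto simp: gauss_borel_def)
  \<comment> \<open>The lower triangular matrix that takes the polynomials of \<open>S2'\<close> to
    those of \<open>S2\<close>.\<close>
  let ?G = "S2 \<odot> bm_inv S2'"
  note lo = lower_unitriangularD(2)
  have G: "?G i j = 0" if "i < j" for i j
    using that
    by (auto simp: bm_mult_lower[OF lo[OF tri(2)]] mm_zero lo[OF bm_inv(1)[OF tri(4)]]
        intro!: sum.neutral)
  have \<omega>H: "\<omega> k l ** H l = H' k ** transpose (?G l k)" for k l
    using arg_cong[OF connection_matrix_transpose_diag[OF gb, of k l], of transpose]
    by (simp add: \<omega>_def matrix_transpose_mul)
  have \<omega>: "matrix_inv (H' k) ** \<omega> k l = transpose (?G l k) ** matrix_inv (H l)" for k l
  proof -
    have "matrix_inv (H' k) ** \<omega> k l = matrix_inv (H' k) ** (\<omega> k l ** (H l ** matrix_inv (H l)))"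
      by (simp add: matrix_inv inv)
    also have "\<dots> = (matrix_inv (H' k) ** H' k) ** transpose (?G l k) ** matrix_inv (H l)"
      by (simp only: matrix_mul_assoc[of "\<omega> k l"] \<omega>H) (simp only: matrix_mul_assoc)
    finally show ?thesis by (simp add: matrix_inv inv)
  qed
  define t where "t k l = transpose (biorth_poly S2' k y) ** matrix_inv (H' k) ** \<omega> k l
      ** biorth_poly S1 l x" for k l
  have t_alt: "t k l = transpose (?G l k ** biorth_poly S2' k y) ** matrix_inv (H l)
      ** biorth_poly S1 l x" for k l
    unfolding t_def matrix_transpose_mul
    by (metis \<omega> matrix_mul_assoc)
  \<comment> \<open>Each form of the summand yields one side of the band: \<open>t_alt\<close> the
    case \<open>l < k\<close>, \<open>t_def\<close> the other.\<close>
  have t0: "t k l = 0" if "l < k \<or> k + ?N < l" for k l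
    using that
  proof
    assume "l < k"
    then show ?thesis by (simp add: t_alt G mm_zero transpose_zero)
  next
    assume "k + ?N < l"
    then show ?thesis by (simp add: t_def \<omega>_def connection_matrix_support tri mm_zero)
  qed
  have kernel: "(\<Sum>k\<le>n. t k l) = transpose (biorth_poly S2 l y) ** matrix_inv (H l) ** biorth_poly S1 l x"
    if "l \<le> n" for l
  proof -
    \<comment> \<open>For \<open>l \<le> n\<close> the cut at \<open>n\<close> loses nothing, so the
      full expansion of the polynomial of \<open>S2\<close> of index \<open>l\<close>
      appears.\<close>
    have "(\<Sum>k\<le>n. t k l) = (\<Sum>k\<le>l. t k l)"
      using that t0 by (intro sum.mono_neutral_right) auto
    then show ?thesis
      by (simp add: t_alt biorth_poly_change[OF tri(2,4), of l y] transpose_sum mm_sum_left)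
  qed
  have "cd_kernel S1' H' S2' n x y ** matpoly_eval W x = (\<Sum>k\<le>n. \<Sum>l\<le>k + ?N. t k l)"
    unfolding cd_kernel_def mm_sum_left t_def \<omega>_def
    by (simp only: matrix_mul_assoc[symmetric] connection_matrix_biorth_poly[OF tri(1,3), symmetric]
        mm_sum_right)
  \<comment> \<open>Padding with zeros makes the inner range independent of \<open>k\<close>, which
    allows the swap.\<close>
  also have "\<dots> = (\<Sum>k\<le>n. \<Sum>l\<le>n + ?N. t k l)"
    using t0 by (intro sum.cong refl sum.mono_neutral_left) auto
  also have "\<dots> = (\<Sum>l\<le>n + ?N. \<Sum>k\<le>n. t k l)"
    by (rule sum.swap)
  also have "{..n + ?N} = {..n} \<union> {n + 1..n + ?N}" by auto
  also have "(\<Sum>l\<in>\<dots>. \<Sum>k\<le>n. t k l)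
      = (\<Sum>l\<le>n. \<Sum>k\<le>n. t k l) + (\<Sum>l\<in>{n + 1..n + ?N}. \<Sum>k\<le>n. t k l)"
    by (rule sum.union_disjoint) auto
  also have "(\<Sum>l\<le>n. \<Sum>k\<le>n. t k l) = cd_kernel S1 H S2 n x y"
    unfolding cd_kernel_def using kernel by (intro sum.cong) auto
  \<comment> \<open>If \<open>k + ?N \<le> n < l\<close> the term lies beyond the band, so exactly
    the rows of the truncation are kept.\<close>
  also have "(\<Sum>l\<in>{n + 1..n + ?N}. \<Sum>k\<le>n. t k l)
      = (\<Sum>l\<in>{n + 1..n + ?N}. \<Sum>k | k \<le> n \<and> n < k + ?N. t k l)"
    by (intro sum.cong refl sum.mono_neutral_right ballI t0) auto
  finally show ?thesis by (simp add: t_def)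
qed

theorem theorem1:
  fixes \<mu> :: "signed_measure ^ 'p ^ 'p"
    and W :: "(real ^ 'p ^ 'p) poly"
    and S1 S2 S1' S2' :: "'p::finite bmat"
    and H H' :: "nat \<Rightarrow> real ^ 'p ^ 'p"
    and N n :: nat
    and x y :: real
  assumes "finite_moments \<mu>"
    and "N \<ge> 1"
    and "monic_matpoly W N"
    and "gauss_borel (moment_matrix \<mu>) S1 H S2"
    and "gauss_borel (perturbed_moment_matrix W \<mu>) S1' H' S2'"
  shows "cd_kernel S1 H S2 n x y +
      blk_mult (trunc_cols n N)
        (blk_mult (trunc_rows n N)
          (blk_mult (trunc_rows n N)
            (biorth_row S2' y)
            (blk_inv (trunc_rows n N) (H_trunc H')))
          (omega_trunc (connection_matrix S1' W S1)))
        (biorth_col S1 x) () ()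
    = cd_kernel S1' H' S2' n x y ** matpoly_eval W x"
proof -
  have N: "degree W = N" using assms(3) by (simp add: monic_matpoly_def)
  have inv: "\<And>k. invertible (H' k)" using assms(5) by (simp add: gauss_borel_def)
  show ?thesis
    using cd_kernel_connection[OF assms(4) assms(5)[unfolded perturbed_moment_matrix_eq[OF assms(1)]]]
    by (simp add: truncated_term_eq[OF inv] N)
qed

end
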